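(* Let $f:X\to X$ be a pointwise periodic homeomorphism of a compact metric space $X$. Then the following are true: (i) Any transitive subsystem of $(2^X,2^f)$ is without periodic points unless it has a finite phase space which is a periodic orbit. In particular, $(2^X,2^f)$ has no Devaney chaotic subsystems. (ii) $(2^X,2^f)$ is topologically transitive if and only if $X$ is trivial (i.e., a single point). In particular, $(2^X,2^f)$ is neither Auslander-Yorke chaotic nor Devaney chaotic.
   Context: $f$ is pointwise periodic if every point of $X$ is periodic, i.e. for every $x\in X$ there is an integer $n\geq 1$ with $f^n(x)=x$. $2^X$ is the hyperspace of all nonempty closed subsets of $X$ with the Hausdorff metric, and $2^f:2^X\to 2^X$ is the induced map $2^f(A)=f(A)$. A dynamical system is a pair $(Z,g)$ with $Z$ a compact metric space (with metric $\rho$) and $g:Z\to Z$ continuous; a subsystem is $(L,g|_L)$ with $L\subset Z$ nonempty, closed and $g(L)\subset L$. $(Z,g)$ is (topologically) transitive if for any nonempty open subsets $U,V$ of $Z$ there exists an integer $n\geq 1$ such that $g^{-n}(U)\cap V\neq\emptyset$. $(Z,g)$ is sensitive if there is $\delta>0$ such that for any $z\in Z$ and any $\varepsilon>0$ there is $n\in\mathbb{N}$ such that $\rho(g^n(z),g^n(y))>\delta$ for some $y\in Z$ with $\rho(z,y)<\varepsilon$. $(Z,g)$ is Auslander-Yorke chaotic if it is transitive and sensitive. $(Z,g)$ is Devaney chaotic if it is transitive and has a dense set of periodic points.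
   Formalization: The claims of no Devaney chaos are false as written, since {X} is a Devaney chaotic subsystem: in (i) subsystems that are finite periodic orbits are excepted, and in (ii) "not Devaney chaotic" is claimed only when X is not a single point. *)

theory Defs
  imports "HOL-Analysis.Analysis"
begin

text \<open>
  A dynamical system is given by a carrier \<open>Z\<close>, a metric \<open>d\<close> on \<open>Z\<close>
  and a map \<open>g\<close>.  Values of \<open>g\<close> outside \<open>Z\<close> are irrelevant, so the subsystem with phase
  space \<open>L\<close> is given by \<open>L\<close> with the same \<open>d\<close> and \<open>g\<close>.
\<close>

definition periodic_point :: "('z \<Rightarrow> 'z) \<Rightarrow> 'z \<Rightarrow> bool" where
  "periodic_point g z \<longleftrightarrow> (\<exists>n\<ge>1. (g ^^ n) z = z)"

definition pointwise_periodic_on :: "'z set \<Rightarrow> ('z \<Rightarrow> 'z) \<Rightarrow> bool" where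
  "pointwise_periodic_on Z g \<longleftrightarrow> (\<forall>z\<in>Z. periodic_point g z)"

definition periodic_orbit :: "('z \<Rightarrow> 'z) \<Rightarrow> 'z set \<Rightarrow> bool" where
  "periodic_orbit g L \<longleftrightarrow> (\<exists>z. periodic_point g z \<and> L = {(g ^^ n) z | n. True})"

definition subsystem :: "'z set \<Rightarrow> ('z \<Rightarrow> 'z \<Rightarrow> real) \<Rightarrow> ('z \<Rightarrow> 'z) \<Rightarrow> 'z set \<Rightarrow> bool" where
  "subsystem Z d g L \<longleftrightarrow>
     L \<noteq> {} \<and> closedin (Metric_space.mtopology Z d) L \<and> g ` L \<subseteq> L"

definition transitive_system :: "'z set \<Rightarrow> ('z \<Rightarrow> 'z \<Rightarrow> real) \<Rightarrow> ('z \<Rightarrow> 'z) \<Rightarrow> bool" where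
  "transitive_system Z d g \<longleftrightarrow>
     (\<forall>U V. openin (Metric_space.mtopology Z d) U \<and> U \<noteq> {} \<and>
            openin (Metric_space.mtopology Z d) V \<and> V \<noteq> {}
        \<longrightarrow> (\<exists>n\<ge>1. ((g ^^ n) -` U) \<inter> V \<noteq> {}))"

definition sensitive_system :: "'z set \<Rightarrow> ('z \<Rightarrow> 'z \<Rightarrow> real) \<Rightarrow> ('z \<Rightarrow> 'z) \<Rightarrow> bool" where
  "sensitive_system Z d g \<longleftrightarrow>
     (\<exists>\<delta>>0. \<forall>z\<in>Z. \<forall>\<epsilon>>0. \<exists>n. \<exists>y\<in>Z. d z y < \<epsilon> \<and> d ((g ^^ n) z) ((g ^^ n) y) > \<delta>)"

definition auslander_yorke_chaotic :: "'z set \<Rightarrow> ('z \<Rightarrow> 'z \<Rightarrow> real) \<Rightarrow> ('z \<Rightarrow> 'z) \<Rightarrow> bool" where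
  "auslander_yorke_chaotic Z d g \<longleftrightarrow> transitive_system Z d g \<and> sensitive_system Z d g"

definition devaney_chaotic :: "'z set \<Rightarrow> ('z \<Rightarrow> 'z \<Rightarrow> real) \<Rightarrow> ('z \<Rightarrow> 'z) \<Rightarrow> bool" where
  "devaney_chaotic Z d g \<longleftrightarrow>
     transitive_system Z d g \<and>
     Metric_space.mtopology Z d closure_of {z \<in> Z. periodic_point g z} = Z"

definition hyperspace :: "'a set \<Rightarrow> ('a \<Rightarrow> 'a \<Rightarrow> real) \<Rightarrow> 'a set set" where
  "hyperspace X d = {A. A \<noteq> {} \<and> closedin (Metric_space.mtopology X d) A}"

text \<open>
  The value 0 outside the hyperspace is a dummy: \<^locale>\<open>Metric_space\<close> demands nonnegativity
  and symmetry on the whole type, and the suprema below are unspecified for sets that are empty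
  or unbounded.
\<close>

definition hausdorff_dist ::
    "'a set \<Rightarrow> ('a \<Rightarrow> 'a \<Rightarrow> real) \<Rightarrow> 'a set \<Rightarrow> 'a set \<Rightarrow> real" where
  "hausdorff_dist X d A B =
     (if A \<in> hyperspace X d \<and> B \<in> hyperspace X d
      then max (SUP a\<in>A. INF b\<in>B. d a b) (SUP b\<in>B. INF a\<in>A. d b a)
      else 0)"

end

theory Submission
  imports Defs
begin

text \<open>
  Suppose \<open>f ` A = A\<close> and \<open>f\<^sup>q ` C\<close> comes arbitrarily close to \<open>A\<close> in the Hausdorff distance.  Orbits
  of points are finite, so each point of \<open>C\<close> has an iterate in \<open>A\<close> and hence lies in \<open>A\<close>.
  By Baire the interiors, relative to \<open>A\<close>, of the sets of fixed points of \<open>f\<^sup>N\<close> have a dense union,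
  and on each of these interiors the iterates of \<open>C\<close> recur periodically, so closeness to \<open>A\<close> forces
  \<open>C\<close> to be dense in \<open>A\<close>: therefore \<open>C = A\<close>.  Applied to powers of \<open>f\<close>, this shows that a periodic
  set is accumulated only by the orbits of its own iterates.  In a transitive subsystem of the
  hyperspace with a periodic point \<open>A\<close>, Baire makes the elements accumulating on \<open>A\<close> dense, so the
  phase space is the finite orbit of \<open>A\<close>.  For the hyperspace itself, the fixed point \<open>X\<close> leaves
  \<open>{X}\<close> as the only possible phase space.
\<close>

section \<open>The Hausdorff metric on the hyperspace of a compact metric space\<close>

locale compact_metric_space = Metric_space +
  assumes compact: "compact_space mtopology"
begin

lemma hyperspaceD:
  assumes "A \<in> hyperspace M d"
  shows "A \<noteq> {}" "closedin mtopology A" "A \<subseteq> M"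
  using assms closedin_subset[of mtopology A] by (auto simp: hyperspace_def)

lemma closedin_approx:
  assumes "closedin mtopology A" "x \<in> M" "\<And>e. e > 0 \<Longrightarrow> \<exists>a\<in>A. d x a < e"
  shows "x \<in> A"
proof (rule ccontr)
  assume "x \<notin> A"
  then obtain r where r: "r > 0" "disjnt A (mball x r)"
    using assms(1,2) unfolding closedin_metric by blast
  obtain a where "a \<in> A" "d x a < r" using assms(3) r by blast
  then show False
    using r assms(2) closedin_subset[OF assms(1)] by (auto simp: disjnt_iff)
qed

lemma bounded_mdist: obtains K where "\<And>x y. x \<in> M \<Longrightarrow> y \<in> M \<Longrightarrow> d x y \<le> K"
proof -
  have "mbounded M"
    using compact compactin_imp_mbounded compact_space_def by fastforce
  then show thesis
    using that unfolding mbounded_alt by blast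
qed

text \<open>Compactness bounds \<open>d\<close>, so the real supremum does dominate each of the
  infima. Strictness of the bound gives a witness without the infimum having to be attained. With
  \<open>hausdorff_dist_leI\<close>, later proofs can argue with nearby points instead of
  suprema.\<close>

lemma hausdorff_dist_lessD:
  assumes A: "A \<in> hyperspace M d" and B: "B \<in> hyperspace M d"
    and less: "hausdorff_dist M d A B < e" and a: "a \<in> A"
  shows "\<exists>b\<in>B. d a b < e"
proof -
  obtain K where K: "\<And>x y. x \<in> M \<Longrightarrow> y \<in> M \<Longrightarrow> d x y \<le> K"
    using bounded_mdist by blast
  obtain b0 where b0: "b0 \<in> B" using hyperspaceD[OF B] by blast
  have bdd: "bdd_below (d x ` B)" for x
    by (rule bdd_belowI2[of _ 0]) simp
  have "bdd_above ((\<lambda>a. INF b\<in>B. d a b) ` A)"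
  proof (rule bdd_aboveI2)
    fix x assume "x \<in> A"
    then have "d x b0 \<le> K" using K b0 hyperspaceD[OF A] hyperspaceD[OF B] by blast
    then show "(INF b\<in>B. d x b) \<le> K"
      using cINF_lower2[OF bdd b0] by blast
  qed
  then have "(INF b\<in>B. d a b) \<le> (SUP a\<in>A. INF b\<in>B. d a b)"
    using a by (intro cSUP_upper)
  also have "\<dots> < e"
    using less A B by (simp add: hausdorff_dist_def)
  finally show ?thesis
    using cInf_lessD[of "d a ` B" e] b0 by auto
qed

lemma hausdorff_dist_commute: "hausdorff_dist M d A B = hausdorff_dist M d B A"
  by (auto simp: hausdorff_dist_def max.commute)

lemma hausdorff_dist_leI:
  assumes A: "A \<in> hyperspace M d" and B: "B \<in> hyperspace M d"
    and AB: "\<And>a. a \<in> A \<Longrightarrow> \<exists>b\<in>B. d a b \<le> e" and BA: "\<And>b. b \<in> B \<Longrightarrow> \<exists>a\<in>A. d b a \<le> e"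
  shows "hausdorff_dist M d A B \<le> e"
proof -
  have bdd: "bdd_below (d x ` S)" for x S
    by (rule bdd_belowI2[of _ 0]) simp
  have "(SUP a\<in>A. INF b\<in>B. d a b) \<le> e"
    using hyperspaceD(1)[OF A] AB by (intro cSUP_least) (auto intro: cINF_lower2[OF bdd])
  moreover have "(SUP b\<in>B. INF a\<in>A. d b a) \<le> e"
    using hyperspaceD(1)[OF B] BA by (intro cSUP_least) (auto intro: cINF_lower2[OF bdd])
  ultimately show ?thesis
    using A B by (simp add: hausdorff_dist_def)
qed

lemma hausdorff_dist_nonneg: "0 \<le> hausdorff_dist M d A B"
proof (cases "A \<in> hyperspace M d \<and> B \<in> hyperspace M d")
  case True
  then obtain a where a: "a \<in> A" using hyperspaceD by blast
  show ?thesis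
  proof (rule ccontr)
    assume "\<not> ?thesis"
    then obtain b where "d a b < 0"
      using hausdorff_dist_lessD[of A B 0 a] True a by auto
    then show False using nonneg[of a b] by linarith
  qed
qed (auto simp: hausdorff_dist_def)

lemma hausdorff_dist_zero_subset:
  assumes A: "A \<in> hyperspace M d" and B: "B \<in> hyperspace M d" and "hausdorff_dist M d A B = 0"
  shows "A \<subseteq> B"
  using hausdorff_dist_lessD[OF A B] assms(3) closedin_approx hyperspaceD[OF B] hyperspaceD[OF A]
  by (metis subset_iff)

lemma Metric_space_hausdorff_dist: "Metric_space (hyperspace M d) (hausdorff_dist M d)"
proof
  fix A B C
  \<comment> \<open>Nonnegativity and symmetry are required for arbitrary sets, so they are settled
    before \<open>A\<close> and \<open>B\<close> are assumed to lie in the hyperspace.\<close>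
  show "0 \<le> hausdorff_dist M d A B" by (rule hausdorff_dist_nonneg)
  show "hausdorff_dist M d A B = hausdorff_dist M d B A" by (rule hausdorff_dist_commute)
  assume A: "A \<in> hyperspace M d" and B: "B \<in> hyperspace M d"
  show "hausdorff_dist M d A B = 0 \<longleftrightarrow> A = B"
  proof
    assume "hausdorff_dist M d A B = 0"
    then show "A = B"
      using hausdorff_dist_zero_subset A B hausdorff_dist_commute by (metis subset_antisym)
  next
    assume "A = B"
    then have "hausdorff_dist M d A B \<le> 0"
      using A hyperspaceD[OF A] by (intro hausdorff_dist_leI) force+
    then show "hausdorff_dist M d A B = 0"
      using hausdorff_dist_nonneg[of A B] by linarith
  qed
  assume C: "C \<in> hyperspace M d"
  \<comment> \<open>This is one half of the triangle inequality, through a point of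
    \<open>B\<close>. The slack \<open>e\<close> provides the strict bounds that
    \<open>hausdorff_dist_lessD\<close> asks for.\<close>
  have *: "\<exists>c\<in>C. d a c \<le> hausdorff_dist M d A B + hausdorff_dist M d B C + e"
    if A: "A \<in> hyperspace M d" and C: "C \<in> hyperspace M d" and a: "a \<in> A" and e: "e > 0" for a e and A C
  proof -
    obtain b where b: "b \<in> B" "d a b < hausdorff_dist M d A B + e/2"
      using hausdorff_dist_lessD[OF A B, of "hausdorff_dist M d A B + e/2" a] a e by auto
    obtain c where c: "c \<in> C" "d b c < hausdorff_dist M d B C + e/2"
      using hausdorff_dist_lessD[OF B C, of "hausdorff_dist M d B C + e/2" b] b e by auto
    have "d a c \<le> d a b + d b c"
      using A C a b c B hyperspaceD(3) by (meson subsetD triangle)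
    then show ?thesis using b c by (intro bexI[of _ c]) auto
  qed
  show "hausdorff_dist M d A C \<le> hausdorff_dist M d A B + hausdorff_dist M d B C"
  proof (rule field_le_epsilon)
    fix e :: real assume "e > 0"
    then show "hausdorff_dist M d A C \<le> hausdorff_dist M d A B + hausdorff_dist M d B C + e"
      using *[OF A C] *[OF C A] hausdorff_dist_commute[of B] A C
      by (intro hausdorff_dist_leI) (auto simp: add.commute)
  qed
qed

text \<open>The limit of a Cauchy sequence is its upper limit, the intersection of the closed tails
  \<open>C N\<close>, which is nonempty by compactness. Completeness is wanted for the Baire
  argument in subsystems.\<close>

lemma mcomplete_hausdorff_dist: "Metric_space.mcomplete (hyperspace M d) (hausdorff_dist M d)"
proof -
  interpret H: Metric_space "hyperspace M d" "hausdorff_dist M d"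
    by (rule Metric_space_hausdorff_dist)
  show ?thesis
    unfolding H.mcomplete_def
  proof (intro allI impI)
    fix \<sigma> assume cau: "H.MCauchy \<sigma>"
    then have H: "\<sigma> n \<in> hyperspace M d" for n by (auto simp: H.MCauchy_def)
    define C where "C N = mtopology closure_of (\<Union>n\<in>{N..}. \<sigma> n)" for N
    define A where "A = \<Inter>(range C)"
    have clo: "closedin mtopology (C N)" for N by (simp add: C_def)
    have dec: "decseq C"
      unfolding C_def decseq_def by (intro allI impI closure_of_mono UN_mono) auto
    have sub: "\<sigma> n \<subseteq> C N" if "n \<ge> N" for n N
    proof -
      have "(\<Union>n\<in>{N..}. \<sigma> n) \<subseteq> C N"
        unfolding C_def using H hyperspaceD(3) by (intro closure_of_subset) auto
      then show ?thesis using that by blast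
    qed
    have "C N \<noteq> {}" for N using sub[of N N] H[of N] hyperspaceD(1) by blast
    then have "A \<noteq> {}"
      using compact clo dec unfolding A_def compact_space_nest by blast
    moreover have "closedin mtopology A"
      unfolding A_def using clo by (intro closedin_Inter) auto
    ultimately have AH: "A \<in> hyperspace M d" by (simp add: hyperspace_def)
    have "\<exists>N. \<forall>n\<ge>N. hausdorff_dist M d (\<sigma> n) A < e" if e: "e > 0" for e
    proof -
      obtain N where N: "\<And>n m. n \<ge> N \<Longrightarrow> m \<ge> N \<Longrightarrow> hausdorff_dist M d (\<sigma> n) (\<sigma> m) < e/4"
        using cau e unfolding H.MCauchy_def by (meson divide_pos_pos zero_less_numeral)
      have "hausdorff_dist M d (\<sigma> n) A \<le> e/2" if n: "n \<ge> N" for n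
      proof (rule hausdorff_dist_leI[OF H AH])
        fix a assume a: "a \<in> A"
        then have "a \<in> C N" by (auto simp: A_def)
        then have "\<exists>y\<in>\<Union>(\<sigma> ` {N..}). y \<in> mball a (e/4)"
          using divide_pos_pos[OF e zero_less_numeral] unfolding C_def metric_closure_of by blast
        then obtain m y where m: "m \<ge> N" "y \<in> \<sigma> m" "d a y < e/4" by auto
        obtain b where b: "b \<in> \<sigma> n" "d y b < e/4"
          using hausdorff_dist_lessD[OF H H N m(2)] m n by blast
        have "d a b \<le> d a y + d y b"
          using a m b H AH hyperspaceD(3) by (meson subsetD triangle)
        then show "\<exists>b\<in>\<sigma> n. d a b \<le> e/2" using b m by force
      next
        fix b assume b: "b \<in> \<sigma> n"
        have bM: "b \<in> M" using b H hyperspaceD(3) by blast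
        \<comment> \<open>Points near \<open>b\<close> in late members of the sequence make every
          \<open>D k\<close> nonempty. Closed balls keep these decreasing sets closed, so
          compactness gives a common point, which lies in \<open>A\<close> and close to
          \<open>b\<close>.\<close>
        define D where "D k = C k \<inter> mcball b (e/4)" for k
        have "D k \<noteq> {}" for k
        proof -
          obtain y where "y \<in> \<sigma> (max N k)" "d b y < e/4"
            using hausdorff_dist_lessD[OF H H N b, of "max N k"] n by auto
          then have "y \<in> D k"
            using sub[of k "max N k"] bM H hyperspaceD(3) unfolding D_def by fastforce
          then show ?thesis by blast
        qed
        moreover have "closedin mtopology (D k)" for k
          unfolding D_def using clo by (intro closedin_Int) auto
        moreover have "decseq D"
          using dec unfolding D_def decseq_def by blast
        ultimately obtain a where a: "a \<in> \<Inter>(range D)"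
          using compact unfolding compact_space_nest by blast
        have "a \<in> A" "d b a \<le> e/4" using a by (auto simp: A_def D_def)
        then show "\<exists>a\<in>A. d b a \<le> e/2" using e by force
      qed
      moreover have "e/2 < e" using e by simp
      ultimately show ?thesis by (meson le_less_trans)
    qed
    then have "limitin H.mtopology \<sigma> A sequentially"
      using AH H by (simp add: H.limit_metric_sequentially)
    then show "\<exists>A. limitin H.mtopology \<sigma> A sequentially" ..
  qed
qed

lemma image_in_hyperspace:
  assumes f: "continuous_map mtopology mtopology f" and A: "A \<in> hyperspace M d"
  shows "f ` A \<in> hyperspace M d"
proof -
  have "compactin mtopology A"
    using hyperspaceD[OF A] compact closedin_compact_space by blast
  then have "compactin mtopology (f ` A)"
    using f image_compactin by blast
  then show ?thesis
    using hyperspaceD[OF A] Hausdorff_space_mtopology compactin_imp_closedin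
    by (auto simp: hyperspace_def)
qed

text \<open>By compactness \<open>f\<close> is uniformly continuous, and a radius that serves
  \<open>f\<close> for \<open>e/2\<close> serves the induced map for \<open>e\<close>, since
  \<open>f\<close> carries nearby witnesses to nearby witnesses.\<close>

lemma continuous_map_hausdorff_dist_image:
  assumes f: "continuous_map mtopology mtopology f"
  shows "continuous_map (Metric_space.mtopology (hyperspace M d) (hausdorff_dist M d))
    (Metric_space.mtopology (hyperspace M d) (hausdorff_dist M d)) (image f)"
proof -
  interpret H: Metric_space "hyperspace M d" "hausdorff_dist M d"
    by (rule Metric_space_hausdorff_dist)
  have uc: "uniformly_continuous_map Self Self f"
    using f compact by (intro continuous_imp_uniformly_continuous_map) (simp add: mtopology_of_def)
  have "\<exists>\<delta>>0. \<forall>B. B \<in> hyperspace M d \<and> hausdorff_dist M d A B < \<delta> \<longrightarrow>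
          hausdorff_dist M d (f ` A) (f ` B) < e"
    if A: "A \<in> hyperspace M d" and e: "e > 0" for A e
  proof -
    obtain \<delta> where \<delta>: "\<delta> > 0" "\<And>x y. x \<in> M \<Longrightarrow> y \<in> M \<Longrightarrow> d x y < \<delta> \<Longrightarrow> d (f x) (f y) < e/2"
      using uc e unfolding uniformly_continuous_map_def mspace_Self mdist_Self
      by (meson half_gt_zero)
    have *: "\<exists>b\<in>f ` B. d a b \<le> e/2"
      if A: "A \<in> hyperspace M d" and B: "B \<in> hyperspace M d"
        and AB: "hausdorff_dist M d A B < \<delta>" and a: "a \<in> f ` A" for A B a
    proof -
      obtain x where x: "x \<in> A" "a = f x" using a by blast
      then obtain y where y: "y \<in> B" "d x y < \<delta>" using hausdorff_dist_lessD[OF A B AB] by blast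
      then have "d (f x) (f y) < e/2" using \<delta> x hyperspaceD(3)[OF A] hyperspaceD(3)[OF B] by blast
      then show ?thesis using x y by force
    qed
    have "hausdorff_dist M d (f ` A) (f ` B) \<le> e/2"
      if B: "B \<in> hyperspace M d" and "hausdorff_dist M d A B < \<delta>" for B
      using that *[OF A B] *[OF B A] hausdorff_dist_commute[of A B] image_in_hyperspace[OF f] A
      by (intro hausdorff_dist_leI) auto
    then show ?thesis using e \<delta>(1) by (intro exI[of _ \<delta>]) force
  qed
  then show ?thesis
    using image_in_hyperspace[OF f]
    by (subst H.metric_continuous_map[OF H.Metric_space_axioms]) (simp add: image_subset_iff)
qed

end

section \<open>Iterates, finite index sets and interiors\<close>

lemma uniform_index_of_finite:
  fixes P :: "'i \<Rightarrow> real \<Rightarrow> bool"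
  assumes "finite F" and ex: "\<And>e. e > 0 \<Longrightarrow> \<exists>j\<in>F. P j e"
    and mono: "\<And>j e e'. P j e \<Longrightarrow> e \<le> e' \<Longrightarrow> P j e'"
  shows "\<exists>j\<in>F. \<forall>e>0. P j e"
proof (rule ccontr)
  assume "\<not> ?thesis"
  then obtain \<epsilon> where \<epsilon>: "\<And>j. j \<in> F \<Longrightarrow> \<epsilon> j > 0 \<and> \<not> P j (\<epsilon> j)"
    by metis
  have "F \<noteq> {}" using ex[of 1] by auto
  \<comment> \<open>An index that is good at the smallest failing radius would, by monotonicity, be
    good at its own failing radius.\<close>
  then have "Min (\<epsilon> ` F) > 0" using \<epsilon> assms(1) by simp
  then obtain j where "j \<in> F" "P j (Min (\<epsilon> ` F))" using ex by blast
  then show False using \<epsilon> mono assms(1) by (meson Min_le finite_imageI imageI)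
qed

lemma funpow_image:
  fixes f :: "'a \<Rightarrow> 'a"
  shows "(image f ^^ n) A = (f ^^ n) ` A"
  by (induction n) auto

lemma funpow_mult_id: "(f ^^ n) x = x \<Longrightarrow> (f ^^ (n * m)) x = x"
  by (induction m) (auto simp: funpow_add)

lemma inj_on_funpow:
  assumes "inj_on f S" "f ` S \<subseteq> S"
  shows "inj_on (f ^^ n) S"
proof (induction n)
  case (Suc n)
  have "(f ^^ n) ` S \<subseteq> S"
    using assms(2) by (induction n) auto
  then show ?case
    using Suc assms(1) comp_inj_on inj_on_subset by (metis funpow.simps(2))
qed auto

lemma continuous_map_funpow:
  "continuous_map X X f \<Longrightarrow> continuous_map X X (f ^^ n)"
proof (induction n)
  case (Suc n)
  then show ?case using continuous_map_compose by (metis funpow.simps(2))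
qed (simp add: id_def)

text \<open>If \<open>f ^^ n\<close> fixes a point, so does \<open>f ^^ (n * k)\<close>, which is
  the \<open>n\<close>-th iterate of \<open>f ^^ k\<close>.\<close>

lemma pointwise_periodic_on_funpow:
  "pointwise_periodic_on S f \<Longrightarrow> pointwise_periodic_on S (f ^^ k)"
  unfolding pointwise_periodic_on_def periodic_point_def
  by (metis funpow_mult_id funpow_mult mult.commute)

lemma periodic_orbit_eq:
  assumes "(g ^^ k) z = z" "k \<ge> 1"
  shows "{(g ^^ n) z | n. True} = (\<lambda>n. (g ^^ n) z) ` {..<k}"
proof -
  have "(g ^^ n) z \<in> (\<lambda>n. (g ^^ n) z) ` {..<k}" for n
    using funpow_mod_eq[OF assms(1), of n] assms(2)
    by (intro image_eqI[of _ _ "n mod k"]) auto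
  then show ?thesis by auto
qed

text \<open>An open set inside the difference lies in \<open>S\<close>, hence in the interior that
  was removed. For closed \<open>S\<close> the difference is therefore nowhere dense, as Baire's
  theorem requires.\<close>

lemma interior_of_diff_interior_of:
  "T interior_of (S - T interior_of S) = {}"
proof -
  have "T interior_of (S - T interior_of S) \<subseteq> T interior_of S"
    by (simp add: interior_of_mono)
  moreover have "T interior_of (S - T interior_of S) \<subseteq> S - T interior_of S"
    by (rule interior_of_subset)
  ultimately show ?thesis by blast
qed

section \<open>Closed sets whose images approach a periodic set, and transitive subsystems\<close>

context compact_metric_space
begin

text \<open>The fixed-point sets \<open>F N\<close> of the iterates are closed and cover
  \<open>M\<close>. The open set \<open>M - C\<close> avoids all their interiors \<open>I N\<close>,
  so it lies in the union of the nowhere dense sets \<open>F N - I N\<close> and is empty by Baire.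
  In \<open>approx\<close> one \<open>q\<close> serves all \<open>a\<close>, because the point to be
  approximated is chosen after \<open>q\<close>.\<close>

lemma eq_space_if_images_dense:
  assumes h: "continuous_map mtopology mtopology h" and inj: "inj_on h M"
    and per: "pointwise_periodic_on M h" and C: "closedin mtopology C"
    and approx: "\<And>e. e > 0 \<Longrightarrow> \<exists>q. \<forall>a\<in>M. \<exists>c\<in>C. d a ((h ^^ q) c) < e"
  shows "C = M"
proof -
  have CM: "C \<subseteq> M" using closedin_subset[OF C] by simp
  have hM: "(h ^^ n) x \<in> M" if "x \<in> M" for n x
    using continuous_map_funpow[OF h, of n] that by (auto simp: continuous_map_def)
  have injn: "inj_on (h ^^ n) M" for n
    using inj_on_funpow inj hM[of _ 1] by auto
  define F where "F N = {x \<in> M. (h ^^ N) x = x}" for N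
  define I where "I N = mtopology interior_of (F N)" for N
  have cloF: "closedin mtopology (F N)" for N
    unfolding F_def
    using closedin_continuous_maps_eq[OF Hausdorff_space_mtopology continuous_map_funpow[OF h, of N] continuous_map_id]
    by simp
  have M_eq: "M = (\<Union>N\<in>{1..}. F N)"
    using per by (auto simp: F_def pointwise_periodic_on_def periodic_point_def)
  have "mtopology interior_of \<Union>((\<lambda>N. F N - I N) ` {1..}) = {}"
  proof (rule metric_Baire_category_alt)
    show "mcomplete" using compact compact_space_imp_mcomplete by blast
    fix T assume "T \<in> (\<lambda>N. F N - I N) ` {1..}"
    then show "closedin mtopology T \<and> mtopology interior_of T = {}"
      using cloF by (auto simp: I_def interior_of_diff_interior_of intro!: closedin_diff)
  qed auto
  moreover have "M \<inter> - C \<subseteq> \<Union>((\<lambda>N. F N - I N) ` {1..})"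
  proof (rule ccontr)
    assume "\<not> ?thesis"
    then obtain x where x: "x \<in> M" "x \<notin> C" "x \<notin> \<Union>((\<lambda>N. F N - I N) ` {1..})" by auto
    then obtain N where N: "N \<ge> 1" "x \<in> I N" using M_eq by auto
    \<comment> \<open>An iterate \<open>h\<^sup>q c\<close> close to \<open>h\<^sup>i x\<close> with \<open>i = q mod N\<close> is carried by \<open>h\<^sup>N\<^sup>-\<^sup>i\<close> to a point \<open>z\<close> near \<open>x\<close>;
      as \<open>h\<^sup>N\<close> fixes \<open>z\<close> and \<open>N\<close> divides \<open>q + N - i\<close>, injectivity gives \<open>z = c\<close>.\<close>
    have "openin mtopology (I N \<inter> (M - C))"
      using C by (intro openin_Int openin_diff) (auto simp: I_def)
    then obtain r where r: "r > 0" "mball x r \<subseteq> I N \<inter> (M - C)"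
      using x N unfolding openin_mtopology by blast
    have IF: "I N \<subseteq> F N" unfolding I_def by (rule interior_of_subset)
    have xN: "(h ^^ N) x = x" using N IF by (auto simp: F_def)
    \<comment> \<open>The radius is fixed before \<open>q\<close>, so it has to serve every possible
      residue of \<open>q\<close> modulo \<open>N\<close>. These are finitely many, and the minimum
      of their radii works.\<close>
    have "\<exists>\<delta>>0. \<forall>i\<le>N. \<forall>y\<in>M. d ((h ^^ i) x) y < \<delta> \<longrightarrow> d x ((h ^^ (N - i)) y) < r"
    proof -
      have "\<exists>\<delta>>0. \<forall>y\<in>M. d ((h ^^ i) x) y < \<delta> \<longrightarrow> d x ((h ^^ (N - i)) y) < r" if "i \<le> N" for i
      proof -
        have "(h ^^ (N - i)) ((h ^^ i) x) = x"
          using xN that by (metis add.commute comp_apply funpow_add le_add_diff_inverse)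
        then show ?thesis
          using continuous_map_funpow[OF h, of "N - i"] hM[OF x(1), of i] r(1)
          unfolding metric_continuous_map[OF Metric_space_axioms] by metis
      qed
      then obtain \<delta> where \<delta>: "\<And>i. i \<le> N \<Longrightarrow> \<delta> i > 0"
        "\<And>i y. i \<le> N \<Longrightarrow> y \<in> M \<Longrightarrow> d ((h ^^ i) x) y < \<delta> i \<Longrightarrow> d x ((h ^^ (N - i)) y) < r"
        by metis
      show ?thesis
        by (rule exI[of _ "Min (\<delta> ` {..N})"]) (use \<delta> in \<open>auto simp: Min_gr_iff\<close>)
    qed
    then obtain \<delta> where \<delta>: "\<delta> > 0"
      "\<And>i y. i \<le> N \<Longrightarrow> y \<in> M \<Longrightarrow> d ((h ^^ i) x) y < \<delta> \<Longrightarrow> d x ((h ^^ (N - i)) y) < r"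
      by blast
    obtain q where q: "\<And>a. a \<in> M \<Longrightarrow> \<exists>c\<in>C. d a ((h ^^ q) c) < \<delta>"
      using approx[OF \<delta>(1)] by blast
    define i where "i = q mod N"
    have i: "i \<le> N" using N by (simp add: i_def less_imp_le)
    obtain c where c: "c \<in> C" "d ((h ^^ i) x) ((h ^^ q) c) < \<delta>"
      using q[OF hM[OF x(1)]] by blast
    have cM: "c \<in> M" using c CM by blast
    define z where "z = (h ^^ (N - i)) ((h ^^ q) c)"
    have z: "z \<in> M" "d x z < r" unfolding z_def using \<delta>(2)[OF i hM c(2)] cM hM by auto
    then have zI: "z \<in> F N" "z \<notin> C" using r x IF by auto
    have "N - i + q = N * (q div N + 1)"
      using i unfolding i_def by (simp add: algebra_simps minus_mod_eq_mult_div [symmetric] mod_less_eq_dividend)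
    then have "z = (h ^^ (N * (q div N + 1))) c"
      unfolding z_def by (metis comp_apply funpow_add)
    moreover have "z = (h ^^ (N * (q div N + 1))) z"
      using zI funpow_mult_id by (metis (mono_tags, lifting) F_def mem_Collect_eq)
    ultimately have "z = c"
      using injn cM z by (metis inj_on_def)
    then show False using c zI by blast
  qed
  moreover have "openin mtopology (M - C)" using C by blast
  ultimately have "M - C \<subseteq> {}"
    by (metis Diff_eq interior_of_maximal)
  then show ?thesis using CM by blast
qed

text \<open>The two halves of the closeness have different tasks. Images of points of
  \<open>C\<close> approach \<open>A\<close>, and a finite orbit comes arbitrarily close to a closed
  set only by meeting it; this gives \<open>C \<subseteq> A\<close>. The other half is then the
  hypothesis of \<open>eq_space_if_images_dense\<close> for the space \<open>A\<close>.\<close>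

lemma invariant_set_limit_of_images:
  assumes h: "continuous_map mtopology mtopology h" and inj: "inj_on h M"
    and per: "pointwise_periodic_on M h"
    and A: "closedin mtopology A" "h ` A = A" and C: "closedin mtopology C"
    and approx: "\<And>e. e > 0 \<Longrightarrow> \<exists>q. (\<forall>a\<in>A. \<exists>c\<in>C. d a ((h ^^ q) c) < e) \<and>
                                (\<forall>c\<in>C. \<exists>a\<in>A. d ((h ^^ q) c) a < e)"
  shows "C = A"
proof -
  have AM: "A \<subseteq> M" and CM: "C \<subseteq> M" using closedin_subset A C by force+
  have hM: "(h ^^ n) x \<in> M" if "x \<in> M" for n x
    using continuous_map_funpow[OF h, of n] that by (auto simp: continuous_map_def)
  have hA: "(h ^^ n) x \<in> A" if "x \<in> A" for n x
    using that A(2) by (induction n) auto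
  have CA: "C \<subseteq> A"
  proof
    fix c assume c: "c \<in> C"
    then obtain p where p: "p \<ge> 1" "(h ^^ p) c = c"
      using per CM by (auto simp: pointwise_periodic_on_def periodic_point_def)
    \<comment> \<open>The time depends on \<open>e\<close>, but modulo the period of
      \<open>c\<close> only finitely many times remain, so one of them works for every
      \<open>e\<close>.\<close>
    have "\<exists>q\<in>{..<p}. \<forall>e>0. \<exists>a\<in>A. d ((h ^^ q) c) a < e"
    proof (rule uniform_index_of_finite)
      fix e :: real assume "e > 0"
      then obtain q a where "a \<in> A" "d ((h ^^ q) c) a < e" using approx c by blast
      then show "\<exists>q\<in>{..<p}. \<exists>a\<in>A. d ((h ^^ q) c) a < e"
        using p funpow_mod_eq[OF p(2), of q] by (intro bexI[of _ "q mod p"]) auto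
    qed (auto intro: less_le_trans)
    then obtain q where q: "q < p" "(h ^^ q) c \<in> A"
      using closedin_approx[OF A(1)] hM c CM by blast
    \<comment> \<open>The remaining \<open>p - q\<close> iterations complete the period and stay in
      \<open>A\<close> by invariance.\<close>
    have "c = (h ^^ (p - q)) ((h ^^ q) c)"
      using p q by (metis comp_apply funpow_add le_add_diff_inverse2 less_imp_le)
    then show "c \<in> A" using hA q(2) by metis
  qed
  interpret S: Submetric M d A by unfold_locales (rule AM)
  have "compactin mtopology A" using A compact closedin_compact_space by blast
  then interpret K: compact_metric_space A d
    by unfold_locales (simp add: S.mtopology_submetric compactin_subspace)
  show ?thesis
  proof (rule K.eq_space_if_images_dense)
    show "continuous_map S.sub.mtopology S.sub.mtopology h"
      unfolding S.mtopology_submetric using h A(2)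
      by (auto simp: continuous_map_in_subtopology intro: continuous_map_from_subtopology)
    show "inj_on h A" using inj AM inj_on_subset by blast
    show "pointwise_periodic_on A h" using per AM by (auto simp: pointwise_periodic_on_def)
    show "closedin S.sub.mtopology C"
      unfolding S.mtopology_submetric using C CA by (simp add: closedin_subset_topspace)
    show "\<exists>q. \<forall>a\<in>A. \<exists>c\<in>C. d a ((h ^^ q) c) < e" if "e > 0" for e
      using approx[OF that] by blast
  qed
qed

text \<open>Some residue \<open>j\<close> modulo \<open>k\<close> occurs among arbitrarily good
  approximation times. Along it the images of \<open>(f ^^ j)\<close>
  B\<open>under powers of\<close>f ^^ k\<open>approach\<close>A\<open>, which\<close>f ^^
  k\<open>leaves invariant, so\<close>(f ^^ j) \<open>B = A\<close>.\<close>

lemma periodic_set_limit_of_orbit: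
  assumes f: "continuous_map mtopology mtopology f" and inj: "inj_on f M"
    and per: "pointwise_periodic_on M f"
    and A: "A \<in> hyperspace M d" "(f ^^ k) ` A = A" "k \<ge> 1" and B: "B \<in> hyperspace M d"
    and approx: "\<And>e. e > 0 \<Longrightarrow> \<exists>n. hausdorff_dist M d ((f ^^ n) ` B) A < e"
  shows "\<exists>j. B = (f ^^ j) ` A"
proof -
  have fn: "continuous_map mtopology mtopology (f ^^ n)" for n
    by (rule continuous_map_funpow[OF f])
  have injn: "inj_on (f ^^ n) M" for n
    using continuous_map_image_subset_topspace[OF f] by (intro inj_on_funpow[OF inj]) simp
  have "\<exists>j\<in>{..<k}. \<forall>e>0. \<exists>n. n mod k = j \<and> hausdorff_dist M d ((f ^^ n) ` B) A < e"
  proof (rule uniform_index_of_finite)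
    fix e :: real assume "e > 0"
    then obtain n where "hausdorff_dist M d ((f ^^ n) ` B) A < e" using approx by blast
    then show "\<exists>j\<in>{..<k}. \<exists>n. n mod k = j \<and> hausdorff_dist M d ((f ^^ n) ` B) A < e"
      using A(3) by (intro bexI[of _ "n mod k"] exI[of _ n]) auto
  qed (auto intro: less_le_trans)
  then obtain j where j: "j < k"
    "\<And>e. e > 0 \<Longrightarrow> \<exists>n. n mod k = j \<and> hausdorff_dist M d ((f ^^ n) ` B) A < e"
    by blast
  have "(f ^^ j) ` B = A"
  proof (rule invariant_set_limit_of_images)
    show "continuous_map mtopology mtopology (f ^^ k)" "inj_on (f ^^ k) M"
      "pointwise_periodic_on M (f ^^ k)" "(f ^^ k) ` A = A"
      using fn injn pointwise_periodic_on_funpow[OF per] A by auto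
    show "closedin mtopology A" "closedin mtopology ((f ^^ j) ` B)"
      using A image_in_hyperspace[OF fn B] hyperspaceD by blast+
    fix e :: real assume "e > 0"
    then obtain n where n: "n mod k = j" "hausdorff_dist M d ((f ^^ n) ` B) A < e"
      using j by blast
    have *: "(f ^^ n) b = ((f ^^ k) ^^ (n div k)) ((f ^^ j) b)" for b
    proof -
      have "f ^^ n = f ^^ (k * (n div k) + j)" using n(1) by (simp flip: n(1))
      then show ?thesis by (simp add: funpow_add funpow_mult)
    qed
    have H: "(f ^^ n) ` B \<in> hyperspace M d" by (rule image_in_hyperspace[OF fn B])
    have n': "hausdorff_dist M d A ((f ^^ n) ` B) < e"
      using n(2) by (simp only: hausdorff_dist_commute)
    have "\<exists>c\<in>(f ^^ j) ` B. d a (((f ^^ k) ^^ (n div k)) c) < e" if "a \<in> A" for a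
      using hausdorff_dist_lessD[OF A(1) H n' that] unfolding image_iff * by blast
    moreover have "\<exists>a\<in>A. d (((f ^^ k) ^^ (n div k)) c) a < e" if "c \<in> (f ^^ j) ` B" for c
    proof -
      have "((f ^^ k) ^^ (n div k)) c \<in> (f ^^ n) ` B" using that unfolding image_iff * by blast
      then show ?thesis using hausdorff_dist_lessD[OF H A(1) n(2)] by blast
    qed
    ultimately show "\<exists>q. (\<forall>a\<in>A. \<exists>c\<in>(f ^^ j) ` B. d a (((f ^^ k) ^^ q) c) < e) \<and>
                   (\<forall>c\<in>(f ^^ j) ` B. \<exists>a\<in>A. d (((f ^^ k) ^^ q) c) a < e)"
      by blast
  qed
  moreover have "(f ^^ j) ` (f ^^ (k - j)) ` A = (f ^^ (j + (k - j))) ` A"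
    by (simp only: funpow_add image_comp)
  ultimately have "(f ^^ j) ` B = (f ^^ j) ` (f ^^ (k - j)) ` A"
    using A(2) j(1) by simp
  then have "B = (f ^^ (k - j)) ` A"
    using inj_on_image_eq_iff[OF injn hyperspaceD(3)[OF B] hyperspaceD(3)[OF image_in_hyperspace[OF fn A(1)]]]
    by blast
  then show ?thesis by blast
qed

text \<open>The elements of \<open>L\<close> whose orbits enter every ball about \<open>A\<close>
  form the intersection of the sets \<open>U m\<close>, which are open by continuity and dense by
  transitivity. By Baire this intersection is dense, and by
  \<open>periodic_set_limit_of_orbit\<close> it lies in the orbit of \<open>A\<close>. That orbit is
  finite, hence closed, so it is all of \<open>L\<close>.\<close>

lemma transitive_subsystem_eq_orbit:
  assumes f: "continuous_map mtopology mtopology f" and inj: "inj_on f M"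
    and per: "pointwise_periodic_on M f"
    and L: "subsystem (hyperspace M d) (hausdorff_dist M d) (image f) L"
    and trans: "transitive_system L (hausdorff_dist M d) (image f)"
    and A: "A \<in> L" "periodic_point (image f) A"
  shows "L = {(image f ^^ n) A | n. True}" "finite L"
proof -
  let ?orbit = "{(image f ^^ n) A | n. True}"
  interpret H: Metric_space "hyperspace M d" "hausdorff_dist M d"
    by (rule Metric_space_hausdorff_dist)
  have clo: "closedin H.mtopology L" and fL: "image f ` L \<subseteq> L"
    using L by (auto simp: subsystem_def)
  have LH: "L \<subseteq> hyperspace M d" using closedin_subset[OF clo] by simp
  interpret S: Submetric "hyperspace M d" "hausdorff_dist M d" L
    by unfold_locales (rule LH)
  obtain k where k: "k \<ge> 1" "(image f ^^ k) A = A" using A by (auto simp: periodic_point_def)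
  have fin: "finite ?orbit" using periodic_orbit_eq[OF k(2,1)] by simp
  have fnL: "(image f ^^ n) B \<in> L" if "B \<in> L" for n B
    using that fL by (induction n) auto
  have cont: "continuous_map S.sub.mtopology S.sub.mtopology (image f ^^ n)" for n
  proof (rule continuous_map_funpow)
    show "continuous_map S.sub.mtopology S.sub.mtopology (image f)"
      unfolding S.mtopology_submetric using continuous_map_hausdorff_dist_image[OF f] fL
      by (auto simp: continuous_map_in_subtopology intro: continuous_map_from_subtopology)
  qed
  define U where "U m = {B \<in> L. \<exists>n. (image f ^^ n) B \<in> S.sub.mball A (inverse (real (Suc m)))}" for m
  have "S.sub.mtopology closure_of \<Inter>(range U) = L"
  proof (rule S.sub.metric_Baire_category)
    show "S.sub.mcomplete"
      using S.closedin_mcomplete_imp_mcomplete[OF clo mcomplete_hausdorff_dist] .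
    fix T assume "T \<in> range U"
    then obtain m where m: "T = U m" by blast
    let ?b = "S.sub.mball A (inverse (real (Suc m)))"
    have "U m = (\<Union>n. {B \<in> topspace S.sub.mtopology. (image f ^^ n) B \<in> ?b})"
      by (auto simp: U_def)
    also have "openin S.sub.mtopology \<dots>"
      using openin_continuous_map_preimage[OF cont S.sub.openin_mball] by (intro openin_Union) auto
    finally have "openin S.sub.mtopology (U m)" .
    moreover have "S.sub.mtopology closure_of U m = L"
    proof -
      \<comment> \<open>Transitivity, applied to the ball about \<open>A\<close> and to
        \<open>V\<close>, carries some point of \<open>V\<close> into the ball.\<close>
      have "U m \<inter> V \<noteq> {}" if V: "openin S.sub.mtopology V" "V \<noteq> {}" for V
      proof -
        have "?b \<noteq> {}" using A by (auto simp: S.sub.mball_eq_empty)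
        then obtain n where "((image f ^^ n) -` ?b) \<inter> V \<noteq> {}"
          using trans V S.sub.openin_mball unfolding transitive_system_def by meson
        moreover have "V \<subseteq> L" using openin_subset[OF V(1)] by simp
        ultimately show ?thesis unfolding U_def by blast
      qed
      then show ?thesis
        using dense_intersects_open[of S.sub.mtopology "U m"] by simp
    qed
    ultimately show "openin S.sub.mtopology T \<and> S.sub.mtopology closure_of T = L"
      using m by simp
  qed auto
  moreover have "\<Inter>(range U) \<subseteq> ?orbit"
  proof
    fix B assume B: "B \<in> \<Inter>(range U)"
    then have BL: "B \<in> L" by (auto simp: U_def)
    have "\<exists>j. B = (f ^^ j) ` A"
    proof (rule periodic_set_limit_of_orbit[OF f inj per])
      show "A \<in> hyperspace M d" "B \<in> hyperspace M d" "(f ^^ k) ` A = A" "k \<ge> 1"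
        using A BL LH k by (auto simp: funpow_image)
      fix e :: real assume "e > 0"
      then obtain m where m: "inverse (real (Suc m)) < e" using reals_Archimedean by blast
      have "B \<in> U m" using B by blast
      then show "\<exists>n. hausdorff_dist M d ((f ^^ n) ` B) A < e"
        using m by (auto simp: U_def funpow_image hausdorff_dist_commute[of A] intro: less_trans)
    qed
    then show "B \<in> ?orbit" by (auto simp: funpow_image)
  qed
  moreover have "closedin S.sub.mtopology ?orbit"
    using fin fnL[OF A(1)] S.sub.Hausdorff_space_mtopology
    by (intro closedin_Hausdorff_finite) auto
  ultimately have "L \<subseteq> ?orbit" by (metis closure_of_minimal)
  then show "L = ?orbit" using fnL[OF A(1)] by blast
  then show "finite L" using fin by simp
qed

end

section \<open>Transitivity and chaos of the induced map\<close>

theorem corollary5p3: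
  fixes X :: "'a set" and d :: "'a \<Rightarrow> 'a \<Rightarrow> real" and f :: "'a \<Rightarrow> 'a"
  assumes "Metric_space X d"
    and "X \<noteq> {}"
    and "compact_space (Metric_space.mtopology X d)"
    and "homeomorphic_map (Metric_space.mtopology X d) (Metric_space.mtopology X d) f"
    and "pointwise_periodic_on X f"
  shows
    "(\<forall>L. subsystem (hyperspace X d) (hausdorff_dist X d) (image f) L \<and>
          transitive_system L (hausdorff_dist X d) (image f) \<longrightarrow>
          (\<forall>A\<in>L. \<not> periodic_point (image f) A) \<or>
          (finite L \<and> periodic_orbit (image f) L)) \<and>
     (\<forall>L. subsystem (hyperspace X d) (hausdorff_dist X d) (image f) L \<and>
          \<not> (finite L \<and> periodic_orbit (image f) L) \<longrightarrow>
          \<not> devaney_chaotic L (hausdorff_dist X d) (image f)) \<and>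
     (transitive_system (hyperspace X d) (hausdorff_dist X d) (image f) \<longleftrightarrow> (\<exists>x. X = {x})) \<and>
     \<not> auslander_yorke_chaotic (hyperspace X d) (hausdorff_dist X d) (image f) \<and>
     ((\<nexists>x. X = {x}) \<longrightarrow>
          \<not> devaney_chaotic (hyperspace X d) (hausdorff_dist X d) (image f))"
proof -
  let ?H = "hyperspace X d" and ?hd = "hausdorff_dist X d"
  interpret compact_metric_space X d
    using assms by (simp add: compact_metric_space_def compact_metric_space_axioms_def)
  interpret H: Metric_space ?H ?hd by (rule Metric_space_hausdorff_dist)
  have f: "continuous_map mtopology mtopology f" and inj: "inj_on f X" and surj: "f ` X = X"
    using assms(4) homeomorphic_imp_continuous_map homeomorphic_imp_injective_map
      homeomorphic_imp_surjective_map by fastforce+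
  note orbit = transitive_subsystem_eq_orbit[OF f inj assms(5)]
  have i: "finite L \<and> periodic_orbit (image f) L"
    if "subsystem ?H ?hd (image f) L" "transitive_system L ?hd (image f)"
      "A \<in> L" "periodic_point (image f) A" for L A
    using orbit[OF that] that(4) unfolding periodic_orbit_def by blast
  \<comment> \<open>Density of periodic points in the nonempty \<open>L\<close> provides one, and
    \<open>i\<close> applies. Finite periodic orbits are excluded because they are transitive and
    consist of periodic points, so they satisfy the Devaney conditions.\<close>
  have i': "\<not> devaney_chaotic L ?hd (image f)"
    if L: "subsystem ?H ?hd (image f) L" and no: "\<not> (finite L \<and> periodic_orbit (image f) L)" for L
  proof
    assume dev: "devaney_chaotic L ?hd (image f)"
    have "L \<noteq> {}" using L by (auto simp: subsystem_def)
    then have "{A \<in> L. periodic_point (image f) A} \<noteq> {}"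
      using dev unfolding devaney_chaotic_def by (metis closure_of_empty)
    then show False using i[OF L] no dev by (auto simp: devaney_chaotic_def)
  qed
  have XH: "X \<in> ?H" using assms(2) by (simp add: hyperspace_def)
  have singleton: "{x} \<in> ?H" if "x \<in> X" for x
    using that Hausdorff_space_mtopology by (auto simp: hyperspace_def closedin_Hausdorff_singleton)
  have H_singleton: "?H = {{x}}" if "X = {x}" for x
    using that XH hyperspaceD by (auto simp: subset_singleton_iff)
  have ii: "transitive_system ?H ?hd (image f) \<longleftrightarrow> (\<exists>x. X = {x})"
  proof
    assume trans: "transitive_system ?H ?hd (image f)"
    \<comment> \<open>The whole hyperspace is a subsystem containing the fixed point
      \<open>X\<close>, so it reduces to \<open>{X}\<close>. As it also contains all singletons,
      \<open>X\<close> is a point.\<close>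
    have "subsystem ?H ?hd (image f) ?H"
      using XH image_in_hyperspace[OF f] by (auto simp: subsystem_def)
    moreover have "periodic_point (image f) X"
      unfolding periodic_point_def using surj by (intro exI[of _ 1]) simp
    ultimately have "?H = {(image f ^^ n) X | n. True}"
      using orbit trans XH by blast
    moreover have "(image f ^^ n) X = X" for n by (induction n) (auto simp: surj)
    ultimately have "?H \<subseteq> {X}" by auto
    then show "\<exists>x. X = {x}" using singleton assms(2) by blast
  next
    assume "\<exists>x. X = {x}"
    then obtain x where x: "X = {x}" by blast
    show "transitive_system ?H ?hd (image f)"
      unfolding transitive_system_def
    proof (intro allI impI, elim conjE)
      fix U V assume UV: "openin H.mtopology U" "U \<noteq> {}" "openin H.mtopology V" "V \<noteq> {}"
      have "U \<subseteq> ?H" "V \<subseteq> ?H"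
        using openin_subset[OF UV(1)] openin_subset[OF UV(3)] by auto
      then have "U \<subseteq> {X}" "V \<subseteq> {X}"
        using H_singleton[OF x] x by auto
      then have "X \<in> U" "X \<in> V" using UV by auto
      then show "\<exists>n\<ge>1. ((image f ^^ n) -` U) \<inter> V \<noteq> {}"
        using surj by (intro exI[of _ 1]) auto
    qed
  qed
  \<comment> \<open>Transitivity leaves only a one-point hyperspace, where all distances vanish and
    sensitivity fails. That system does satisfy the Devaney conditions, hence the exclusion of a
    trivial \<open>X\<close> in the last clause.\<close>
  have "\<not> auslander_yorke_chaotic ?H ?hd (image f)"
  proof
    assume ay: "auslander_yorke_chaotic ?H ?hd (image f)"
    then obtain x where x: "X = {x}" using ii by (auto simp: auslander_yorke_chaotic_def)
    obtain \<delta> n B where "\<delta> > 0" "B \<in> ?H" "?hd ((image f ^^ n) X) ((image f ^^ n) B) > \<delta>"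
      using ay XH unfolding auslander_yorke_chaotic_def sensitive_system_def
      by (meson zero_less_one)
    moreover have "(image f ^^ n) X = X" by (induction n) (auto simp: surj)
    moreover have "B = X" using \<open>B \<in> ?H\<close> H_singleton[OF x] x by auto
    ultimately show False using H.mdist_zero[OF XH] by auto
  qed
  then show ?thesis using i i' ii by (auto simp: devaney_chaotic_def)
qed

end
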